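(* Let $X$ be a real vector space and $C$ a nonempty convex subset of $X$. Let $h_n :C\to \mathbb{R}$, $n\in \mathbb{N}$, be a sequence of convex functions converging pointwise on $C$ to some function $h_{\infty}:C\to\mathbb{R}$. Then one and only one of the following alternatives is true: A1) there exists $u_0 \in C$ such that $\sup_{n\in \mathbb{N}} h_n(u_0) <0$; A2) there exists a sequence of real numbers $(\alpha_{\infty}, \alpha_{0},\alpha_{1},\ldots)$ such that $\alpha_{\infty}\geq 0$, $\alpha_{n}\geq 0$ for all $n\in \mathbb{N}$, $\alpha_{\infty}+\sum_{n\geq 0} \alpha_{n}=1$ and $$\alpha_{\infty} h_{\infty}(u)+\sum_{n\geq 0} \alpha_{n} h_n (u)\geq 0\quad\text{for all } u\in C.$$
   Context: $\mathbb{N}=\{0,1,2,\ldots\}$. No topology on $X$ and no continuity of the $h_n$ is assumed. *)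

theory Defs
  imports "HOL-Analysis.Analysis"
begin

end

theory Submission
  imports Defs
begin

text \<open>
  Weights on \<open>\<nat> \<union> {\<infinity>}\<close> are encoded by their finite part \<open>\<alpha>\<close>, the weight of infinity being
  \<open>1 - (\<Sum>n. \<alpha> n)\<close>; such \<open>\<alpha>\<close> form a set that is compact for pointwise convergence. The weighted
  combination becomes \<open>h_inf u + (\<Sum>n. \<alpha> n * (h n u - h_inf u))\<close>, which is continuous in \<open>\<alpha>\<close>
  because \<open>h n u - h_inf u\<close> tends to 0. It is affine in \<open>\<alpha>\<close> and convex in \<open>u\<close>, so a minimax
  argument applies: if no \<open>\<alpha>\<close> is good for all \<open>u\<close>, then by compactness finitely many \<open>u\<close> already
  witness this, and separation in the plane merges these one by one into a single \<open>u\<close> that is bad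
  for every \<open>\<alpha>\<close>. Testing this \<open>u\<close> on the unit masses gives A1.
\<close>

section \<open>Planar separation and the minimax argument\<close>

text \<open>A line strictly separates the compact set from the closed nonnegative quadrant. Since
  the quadrant is a cone, the normal of that line has nonnegative entries, and scaling their sum to
  1 yields the weights \<open>1 - t\<close> and \<open>t\<close>.\<close>

lemma separate_from_quadrant:
  fixes S :: "(real \<times> real) set"
  assumes "convex S" "compact S" and neg: "\<And>x y. (x, y) \<in> S \<Longrightarrow> x < 0 \<or> y < 0"
  obtains t where "0 \<le> t" "t \<le> 1" "\<And>x y. (x, y) \<in> S \<Longrightarrow> (1 - t) * x + t * y < 0"
proof (cases "S = {}")
  case True
  then show ?thesis using that[of 0] by simp
next
  case False
  define Q :: "(real \<times> real) set" where "Q = {0..} \<times> {0..}"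
  have "convex Q" "closed Q" unfolding Q_def by (auto intro: convex_Times closed_Times)
  moreover have "S \<inter> Q = {}" using neg by (force simp: Q_def)
  ultimately obtain a b where S: "\<forall>x\<in>S. inner a x < b" and Q: "\<forall>x\<in>Q. b < inner a x"
    using separating_hyperplane_compact_closed[of S Q] assms False by metis
  obtain p q where a: "a = (p, q)" by fastforce
  have "b < 0" using bspec[OF Q, of "(0, 0)"] by (simp add: a Q_def)
  have "p \<ge> 0"
  proof (rule ccontr)
    assume p: "\<not> p \<ge> 0"
    \<comment> \<open>This point of the axis is chosen so that its inner product with
      \<open>a\<close> is exactly \<open>b\<close>, against the strict bound on
      \<open>Q\<close>.\<close>
    then have "(b / p, 0) \<in> Q" using \<open>b < 0\<close> by (auto simp: Q_def divide_nonpos_nonpos)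
    then show False using Q p by (force simp: a)
  qed
  have "q \<ge> 0"
  proof (rule ccontr)
    assume q: "\<not> q \<ge> 0"
    then have "(0, b / q) \<in> Q" using \<open>b < 0\<close> by (auto simp: Q_def divide_nonpos_nonpos)
    then show False using Q q by (force simp: a)
  qed
  have lt: "p * x + q * y < 0" if "(x, y) \<in> S" for x y
    using S that \<open>b < 0\<close> by (force simp: a)
  \<comment> \<open>A zero normal would turn \<open>lt\<close> into \<open>0 < 0\<close> at any
    point of the nonempty \<open>S\<close>.\<close>
  have pq: "p + q > 0"
  proof (rule ccontr)
    assume "\<not> p + q > 0"
    then have "p = 0" "q = 0" using \<open>p \<ge> 0\<close> \<open>q \<ge> 0\<close> by auto
    then show False using lt False by fastforce
  qed
  show ?thesis
  proof (rule that[of "q / (p + q)"])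
    show "0 \<le> q / (p + q)" "q / (p + q) \<le> 1" using pq \<open>p \<ge> 0\<close> \<open>q \<ge> 0\<close> by auto
    fix x y assume "(x, y) \<in> S"
    have "(1 - q / (p + q)) * x + q / (p + q) * y = (p * x + q * y) / (p + q)"
      using pq by (simp add: divide_simps)
    also have "\<dots> < 0" using lt[OF \<open>(x, y) \<in> S\<close>] pq by (simp add: divide_neg_pos)
    finally show "(1 - q / (p + q)) * x + q / (p + q) * y < 0" .
  qed
qed

text \<open>
  Affinity in the first argument is stated without a linear structure on it, so that the
  hypothesis passes to the subsets \<open>{k \<in> K. F k u \<ge> 0}\<close> used in the induction.
\<close>

lemma minimax_finite:
  fixes F :: "'k::topological_space \<Rightarrow> 'a::real_vector \<Rightarrow> real"
  assumes "finite U" "U \<subseteq> C" "convex C" "C \<noteq> {}"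
    and conv: "\<And>k. k \<in> K \<Longrightarrow> convex_on C (F k)"
    and cont: "\<And>u. u \<in> C \<Longrightarrow> continuous_on K (\<lambda>k. F k u)"
    and "compact K" "closed K"
    and aff: "\<And>k l t. k \<in> K \<Longrightarrow> l \<in> K \<Longrightarrow> 0 \<le> t \<Longrightarrow> t \<le> 1 \<Longrightarrow>
       \<exists>m\<in>K. \<forall>u\<in>C. F m u = (1 - t) * F k u + t * F l u"
    and "\<And>k. k \<in> K \<Longrightarrow> \<exists>u\<in>U. F k u < 0"
  shows "\<exists>w\<in>C. \<forall>k\<in>K. F k w < 0"
  using assms(1,2,5-)
proof (induction U arbitrary: K rule: finite_induct)
  case empty
  then show ?case using \<open>C \<noteq> {}\<close> by blast
next
  case (insert u U)
  note conv = insert.prems(2) and cont = insert.prems(3) and aff = insert.prems(6)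
  have u: "u \<in> C" using insert.prems(1) by simp
  \<comment> \<open>For parameters in \<open>L\<close> the point \<open>u\<close> is no witness, so
    one exists in \<open>U\<close>. Nonnegativity at \<open>u\<close> survives convex combinations,
    hence \<open>L\<close> inherits the affinity condition and the induction hypothesis applies to
    it.\<close>
  define L where "L = K \<inter> (\<lambda>k. F k u) -` {0..}"
  have "L \<subseteq> K" by (auto simp: L_def)
  have "closed L" unfolding L_def
    using continuous_closed_preimage[OF cont[OF u]] insert.prems(5) by simp
  moreover have "compact L"
    using \<open>closed L\<close> \<open>L \<subseteq> K\<close> compact_Int_closed[OF insert.prems(4)] by (metis Int_absorb1)
  moreover have "\<exists>m\<in>L. \<forall>v\<in>C. F m v = (1 - t) * F k v + t * F l v"
    if "k \<in> L" "l \<in> L" "0 \<le> t" "t \<le> 1" for k l t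
  proof -
    have kl: "k \<in> K" "l \<in> K" using that \<open>L \<subseteq> K\<close> by auto
    from aff[OF kl that(3,4)] obtain m
      where m: "m \<in> K" "\<forall>v\<in>C. F m v = (1 - t) * F k v + t * F l v" by blast
    have "F m u \<ge> 0" using m(2) u that by (simp add: L_def)
    then show ?thesis using m by (auto simp: L_def)
  qed
  moreover have "\<exists>v\<in>U. F k v < 0" if "k \<in> L" for k
    using insert.prems(7)[of k] that by (force simp: L_def)
  ultimately have "\<exists>w\<in>C. \<forall>k\<in>L. F k w < 0"
    using insert.prems(1) \<open>L \<subseteq> K\<close> conv continuous_on_subset[OF cont]
    by (intro insert.IH) auto
  then obtain w where w: "w \<in> C" "\<forall>k\<in>L. F k w < 0" by blast
  \<comment> \<open>Each parameter is recorded by its values at \<open>u\<close> and at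
    \<open>w\<close>. Off \<open>L\<close> the first is negative, on \<open>L\<close> the second is,
    so \<open>S\<close> misses the quadrant.\<close>
  define S where "S = (\<lambda>k. (F k u, F k w)) ` K"
  have "compact S" unfolding S_def
    using insert.prems(4) cont u w(1) by (intro compact_continuous_image continuous_on_Pair) auto
  moreover have "convex S"
    unfolding convex_alt
  proof (intro ballI allI impI)
    fix x y and t :: real assume "x \<in> S" "y \<in> S" "0 \<le> t \<and> t \<le> 1"
    then obtain k l where kl: "k \<in> K" "l \<in> K" "x = (F k u, F k w)" "y = (F l u, F l w)"
      by (auto simp: S_def)
    obtain m where "m \<in> K" "\<forall>v\<in>C. F m v = (1 - t) * F k v + t * F l v"
      using aff kl \<open>0 \<le> t \<and> t \<le> 1\<close> by blast
    then show "(1 - t) *\<^sub>R x + t *\<^sub>R y \<in> S"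
      using u w(1) kl by (force simp: S_def)
  qed
  moreover have "x < 0 \<or> y < 0" if "(x, y) \<in> S" for x y
    using that w(2) by (force simp: S_def L_def)
  ultimately obtain t where t: "0 \<le> t" "t \<le> 1"
      "\<And>x y. (x, y) \<in> S \<Longrightarrow> (1 - t) * x + t * y < 0"
    using separate_from_quadrant by metis
  show ?case
  proof (intro bexI ballI)
    \<comment> \<open>The separating weight \<open>t\<close> also places the merged point: convexity
      of \<open>F k\<close> bounds its value there by the weighted sum of the two coordinates, which
      is negative for every \<open>k\<close>.\<close>
    show "(1 - t) *\<^sub>R u + t *\<^sub>R w \<in> C"
      using \<open>convex C\<close> u w(1) t by (simp add: convex_alt)
    fix k assume "k \<in> K"
    then have "F k ((1 - t) *\<^sub>R u + t *\<^sub>R w) \<le> (1 - t) * F k u + t * F k w"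
      using convex_onD[OF conv] t u w(1) by blast
    also have "\<dots> < 0" using t(3) \<open>k \<in> K\<close> by (auto simp: S_def)
    finally show "F k ((1 - t) *\<^sub>R u + t *\<^sub>R w) < 0" .
  qed
qed

text \<open>Finite intersection property: the sets of parameters that are good for one
  \<open>u\<close> are closed in the compact \<open>K\<close>. If finitely many of them had no
  common point, \<open>minimax_finite\<close> would give a \<open>w\<close> that contradicts
  \<open>bad\<close>.\<close>

lemma minimax:
  fixes F :: "'k::topological_space \<Rightarrow> 'a::real_vector \<Rightarrow> real"
  assumes "convex C" "C \<noteq> {}"
    and conv: "\<And>k. k \<in> K \<Longrightarrow> convex_on C (F k)"
    and cont: "\<And>u. u \<in> C \<Longrightarrow> continuous_on K (\<lambda>k. F k u)"
    and "compact K" "closed K"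
    and aff: "\<And>k l t. k \<in> K \<Longrightarrow> l \<in> K \<Longrightarrow> 0 \<le> t \<Longrightarrow> t \<le> 1 \<Longrightarrow>
       \<exists>m\<in>K. \<forall>u\<in>C. F m u = (1 - t) * F k u + t * F l u"
    and bad: "\<And>w. w \<in> C \<Longrightarrow> \<exists>k\<in>K. F k w \<ge> 0"
  shows "\<exists>k\<in>K. \<forall>u\<in>C. F k u \<ge> 0"
proof -
  have "K \<inter> (\<Inter>u\<in>C. K \<inter> (\<lambda>k. F k u) -` {0..}) \<noteq> {}"
  proof (rule compact_imp_fip_image[OF \<open>compact K\<close>])
    show "closed (K \<inter> (\<lambda>k. F k u) -` {0..})" if "u \<in> C" for u
      using continuous_closed_preimage[OF cont[OF that] \<open>closed K\<close>] by simp
    fix U assume U: "finite U" "U \<subseteq> C"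
    have "\<not> (\<forall>k\<in>K. \<exists>u\<in>U. F k u < 0)"
    proof
      assume "\<forall>k\<in>K. \<exists>u\<in>U. F k u < 0"
      then have "\<exists>w\<in>C. \<forall>k\<in>K. F k w < 0"
        using minimax_finite[OF U assms(1,2) conv cont \<open>compact K\<close> \<open>closed K\<close> aff] by blast
      then show False using bad by force
    qed
    then show "K \<inter> (\<Inter>u\<in>U. K \<inter> (\<lambda>k. F k u) -` {0..}) \<noteq> {}"
      by (force simp: not_less)
  qed
  then obtain k where "k \<in> K" "\<And>u. u \<in> C \<Longrightarrow> k \<in> (\<lambda>k. F k u) -` {0..}" by blast
  then show ?thesis by auto
qed

section \<open>The compact set of finite parts of weights\<close>

text \<open>Unit masses at \<open>n\<close> tend pointwise to 0, so total mass exactly 1 would not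
  be a closed condition. Bounding partial sums keeps each constraint on finitely many coordinates,
  which makes closedness immediate.\<close>

definition subprob :: "(nat \<Rightarrow> real) set" where
  "subprob = {\<alpha>. (\<forall>n. 0 \<le> \<alpha> n) \<and> (\<forall>N. (\<Sum>n<N. \<alpha> n) \<le> 1)}"

lemma subprob_iff: "\<alpha> \<in> subprob \<longleftrightarrow> (\<forall>n. 0 \<le> \<alpha> n) \<and> summable \<alpha> \<and> (\<Sum>n. \<alpha> n) \<le> 1"
proof
  assume "\<alpha> \<in> subprob"
  then have a: "\<And>n. 0 \<le> \<alpha> n" "\<And>N. (\<Sum>n<N. \<alpha> n) \<le> 1" by (auto simp: subprob_def)
  have "summable \<alpha>" using summableI_nonneg_bounded a by blast
  then show "(\<forall>n. 0 \<le> \<alpha> n) \<and> summable \<alpha> \<and> (\<Sum>n. \<alpha> n) \<le> 1"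
    using a suminf_le_const by blast
next
  assume a: "(\<forall>n. 0 \<le> \<alpha> n) \<and> summable \<alpha> \<and> (\<Sum>n. \<alpha> n) \<le> 1"
  have "(\<Sum>n<N. \<alpha> n) \<le> (\<Sum>n. \<alpha> n)" for N
    using a by (intro sum_le_suminf) auto
  then show "\<alpha> \<in> subprob" using a by (auto simp: subprob_def intro: order_trans)
qed

lemma closed_subprob: "closed subprob"
  unfolding subprob_def
  by (intro closed_Collect_conj closed_Collect_all closed_Collect_le continuous_on_const
        continuous_on_sum continuous_on_product_coordinates)

text \<open>By Tychonoff, since the set is closed in a product of copies of the unit
  interval.\<close>

lemma compact_subprob: "compact subprob"
proof -
  have "compactin (product_topology (\<lambda>_. euclidean) UNIV) (UNIV \<rightarrow>\<^sub>E {0..1::real})"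
    by (subst compactin_PiE) auto
  then have "compact (UNIV \<rightarrow>\<^sub>E {0..1::real} :: (nat \<Rightarrow> real) set)"
    by (simp add: euclidean_product_topology)
  moreover have "subprob \<subseteq> UNIV \<rightarrow>\<^sub>E {0..1}"
  proof
    fix \<alpha> assume "\<alpha> \<in> subprob"
    then have a: "\<And>n. 0 \<le> \<alpha> n" "\<And>N. (\<Sum>n<N. \<alpha> n) \<le> 1" by (auto simp: subprob_def)
    have "\<alpha> n \<le> (\<Sum>n<Suc n. \<alpha> n)" for n using a(1) by (simp add: sum_nonneg)
    then have "\<alpha> n \<le> 1" for n using a(2) order_trans by blast
    then show "\<alpha> \<in> UNIV \<rightarrow>\<^sub>E {0..1}" using a(1) by auto
  qed
  ultimately show ?thesis
    using compact_Int_closed closed_subprob by (metis Int_absorb1)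
qed

lemma subprob_summable_mult:
  assumes "\<alpha> \<in> subprob" "Bseq g"
  shows "summable (\<lambda>n. \<alpha> n * g n)"
proof -
  obtain B where B: "\<And>n. norm (g n) \<le> B" using \<open>Bseq g\<close> by (auto simp: Bseq_def)
  have a: "\<And>n. 0 \<le> \<alpha> n" "summable \<alpha>" using assms(1) by (auto simp: subprob_iff)
  show ?thesis
    by (rule summable_comparison_test'[OF summable_mult2[OF a(2), of B]])
       (use a(1) B in \<open>auto simp: abs_mult intro!: mult_left_mono\<close>)
qed

text \<open>Finite partial sums are continuous, and they converge uniformly: the total mass is at
  most 1, so a tail is at most the supremum of \<open>\<bar>g n\<bar>\<close> over that tail,
  whatever the weights are.\<close>

lemma continuous_on_subprob:
  fixes g :: "nat \<Rightarrow> real"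
  assumes g: "g \<longlonglongrightarrow> 0"
  shows "continuous_on subprob (\<lambda>\<alpha>. \<Sum>n. \<alpha> n * g n)"
proof (rule uniform_limit_theorem)
  show "\<forall>\<^sub>F N in sequentially. continuous_on subprob (\<lambda>\<alpha>. \<Sum>n<N. \<alpha> n * g n)"
    by (intro always_eventually allI continuous_intros
          continuous_on_subset[OF continuous_on_product_coordinates]) auto
  show "uniform_limit subprob (\<lambda>N \<alpha>. \<Sum>n<N. \<alpha> n * g n) (\<lambda>\<alpha>. \<Sum>n. \<alpha> n * g n) sequentially"
  proof (rule uniform_limitI)
    fix e :: real assume "e > 0"
    then obtain M where M: "\<And>n. n \<ge> M \<Longrightarrow> \<bar>g n\<bar> < e / 2"
      using LIMSEQ_D[OF g, of "e / 2"] by auto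
    have "dist (\<Sum>n<N. \<alpha> n * g n) (\<Sum>n. \<alpha> n * g n) < e" if "N \<ge> M" "\<alpha> \<in> subprob" for N \<alpha>
    proof -
      have a: "\<And>n. 0 \<le> \<alpha> n" "summable \<alpha>" "(\<Sum>n. \<alpha> n) \<le> 1"
        using that(2) by (auto simp: subprob_iff)
      have s: "summable (\<lambda>n. \<alpha> n * g n)"
        using subprob_summable_mult that(2) convergent_imp_Bseq convergentI g by blast
      have sa: "summable (\<lambda>n. \<alpha> (n + N))" using a(2) by (simp add: summable_iff_shift)
      have le: "norm (\<alpha> (n + N) * g (n + N)) \<le> \<alpha> (n + N) * (e / 2)" for n
        using mult_left_mono[OF less_imp_le[OF M[of "n + N"]] a(1)[of "n + N"]] that(1) a(1)
        by (simp add: abs_mult)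
      have "\<bar>\<Sum>n. \<alpha> (n + N) * g (n + N)\<bar> \<le> (\<Sum>n. \<alpha> (n + N) * (e / 2))"
        using norm_suminf_le[OF le summable_mult2[OF sa]] by simp
      also have "\<dots> = (\<Sum>n. \<alpha> (n + N)) * (e / 2)"
        by (rule suminf_mult2[OF sa, symmetric])
      also have "\<dots> \<le> 1 * (e / 2)"
      proof (rule mult_right_mono)
        show "(\<Sum>n. \<alpha> (n + N)) \<le> 1"
          using suminf_split_initial_segment[OF a(2), of N] a(3) sum_nonneg[of "{..<N}" \<alpha>] a(1)
          by auto
      qed (use \<open>e > 0\<close> in auto)
      finally show ?thesis
        using suminf_split_initial_segment[OF s, of N] \<open>e > 0\<close> by (simp add: dist_real_def)
    qed
    then show "\<forall>\<^sub>F N in sequentially. \<forall>\<alpha>\<in>subprob.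
        dist (\<Sum>n<N. \<alpha> n * g n) (\<Sum>n. \<alpha> n * g n) < e"
      unfolding eventually_sequentially by blast
  qed
qed simp

lemma subprob_convex_combination:
  assumes "\<alpha> \<in> subprob" "\<beta> \<in> subprob" "0 \<le> t" "t \<le> 1"
  shows "(\<lambda>n. (1 - t) * \<alpha> n + t * \<beta> n) \<in> subprob"
proof -
  have "(\<Sum>n<N. (1 - t) * \<alpha> n + t * \<beta> n) \<le> 1" for N
  proof -
    have "(\<Sum>n<N. (1 - t) * \<alpha> n + t * \<beta> n) = (1 - t) * (\<Sum>n<N. \<alpha> n) + t * (\<Sum>n<N. \<beta> n)"
      by (simp add: sum.distrib sum_distrib_left)
    also have "\<dots> \<le> (1 - t) * 1 + t * 1"
      using assms by (intro add_mono mult_left_mono) (auto simp: subprob_def)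
    finally show ?thesis by simp
  qed
  then show ?thesis using assms by (auto simp: subprob_def)
qed

section \<open>Convexity of weighted series and of pointwise limits\<close>

lemma convex_on_sum_inf:
  fixes f :: "nat \<Rightarrow> 'a::real_vector \<Rightarrow> real"
  assumes conv: "\<And>n. convex_on C (f n)" and a: "\<And>n. 0 \<le> \<alpha> n"
    and s: "\<And>u. u \<in> C \<Longrightarrow> summable (\<lambda>n. \<alpha> n * f n u)"
  shows "convex_on C (\<lambda>u. \<Sum>n. \<alpha> n * f n u)"
proof (rule convex_onI)
  show "convex C" using conv convex_on_imp_convex by blast
  fix t x y assume t: "0 < t" "t < (1::real)" and x: "x \<in> C" and y: "y \<in> C"
  have z: "(1 - t) *\<^sub>R x + t *\<^sub>R y \<in> C" using \<open>convex C\<close> t x y by (simp add: convex_alt)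
  have "(\<Sum>n. \<alpha> n * f n ((1 - t) *\<^sub>R x + t *\<^sub>R y))
      \<le> (\<Sum>n. (1 - t) * (\<alpha> n * f n x) + t * (\<alpha> n * f n y))"
  proof (rule suminf_le)
    fix n
    have "f n ((1 - t) *\<^sub>R x + t *\<^sub>R y) \<le> (1 - t) * f n x + t * f n y"
      using convex_onD[OF conv] t x y by simp
    then have "\<alpha> n * f n ((1 - t) *\<^sub>R x + t *\<^sub>R y) \<le> \<alpha> n * ((1 - t) * f n x + t * f n y)"
      using a by (intro mult_left_mono)
    then show "\<alpha> n * f n ((1 - t) *\<^sub>R x + t *\<^sub>R y)
        \<le> (1 - t) * (\<alpha> n * f n x) + t * (\<alpha> n * f n y)"
      by (simp add: algebra_simps)
  qed (use s x y z in \<open>auto intro!: summable_add summable_mult\<close>)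
  also have "\<dots> = (1 - t) * (\<Sum>n. \<alpha> n * f n x) + t * (\<Sum>n. \<alpha> n * f n y)"
    using s x y by (simp add: suminf_add[symmetric] suminf_mult summable_mult)
  finally show "(\<Sum>n. \<alpha> n * f n ((1 - t) *\<^sub>R x + t *\<^sub>R y))
      \<le> (1 - t) * (\<Sum>n. \<alpha> n * f n x) + t * (\<Sum>n. \<alpha> n * f n y)" .
qed

lemma convex_on_pointwise_limit:
  fixes f :: "nat \<Rightarrow> 'a::real_vector \<Rightarrow> real"
  assumes conv: "\<And>n. convex_on C (f n)" and lim: "\<And>u. u \<in> C \<Longrightarrow> (\<lambda>n. f n u) \<longlonglongrightarrow> l u"
  shows "convex_on C l"
proof (rule convex_onI)
  show "convex C" using conv convex_on_imp_convex by blast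
  fix t x y assume t: "0 < t" "t < (1::real)" and x: "x \<in> C" and y: "y \<in> C"
  have z: "(1 - t) *\<^sub>R x + t *\<^sub>R y \<in> C" using \<open>convex C\<close> t x y by (simp add: convex_alt)
  show "l ((1 - t) *\<^sub>R x + t *\<^sub>R y) \<le> (1 - t) * l x + t * l y"
  proof (rule LIMSEQ_le[OF lim[OF z]])
    show "(\<lambda>n. (1 - t) * f n x + t * f n y) \<longlonglongrightarrow> (1 - t) * l x + t * l y"
      by (intro tendsto_intros lim x y)
    show "\<exists>N. \<forall>n\<ge>N. f n ((1 - t) *\<^sub>R x + t *\<^sub>R y) \<le> (1 - t) * f n x + t * f n y"
      using convex_onD[OF conv] t x y by simp
  qed
qed

section \<open>The weighted combination and its extremal values\<close>

definition mix :: "(nat \<Rightarrow> real) \<Rightarrow> (nat \<Rightarrow> real) \<Rightarrow> real \<Rightarrow> real" where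
  "mix \<alpha> x l = l + (\<Sum>n. \<alpha> n * (x n - l))"

lemma mix_eq:
  assumes "\<alpha> \<in> subprob" "x \<longlonglongrightarrow> l"
  shows "mix \<alpha> x l = (1 - (\<Sum>n. \<alpha> n)) * l + (\<Sum>n. \<alpha> n * x n)"
proof -
  have "summable \<alpha>" using assms(1) by (simp add: subprob_iff)
  moreover have "summable (\<lambda>n. \<alpha> n * x n)"
    using subprob_summable_mult assms convergent_imp_Bseq convergentI by blast
  ultimately have "(\<Sum>n. \<alpha> n * (x n - l)) = (\<Sum>n. \<alpha> n * x n) - (\<Sum>n. \<alpha> n) * l"
    by (simp add: right_diff_distrib suminf_diff[symmetric] suminf_mult2 summable_mult2)
  then show ?thesis by (simp add: mix_def algebra_simps)
qed

lemma mix_convex_combination: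
  assumes "\<alpha> \<in> subprob" "\<beta> \<in> subprob" "x \<longlonglongrightarrow> l"
  shows "mix (\<lambda>n. (1 - t) * \<alpha> n + t * \<beta> n) x l = (1 - t) * mix \<alpha> x l + t * mix \<beta> x l"
proof -
  have "Bseq (\<lambda>n. x n - l)"
    by (rule convergent_imp_Bseq, rule convergentI, rule tendsto_diff[OF assms(3) tendsto_const])
  then have s: "summable (\<lambda>n. \<alpha> n * (x n - l))" "summable (\<lambda>n. \<beta> n * (x n - l))"
    using assms subprob_summable_mult by blast+
  have "(\<Sum>n. ((1 - t) * \<alpha> n + t * \<beta> n) * (x n - l))
      = (\<Sum>n. (1 - t) * (\<alpha> n * (x n - l)) + t * (\<beta> n * (x n - l)))"
    by (simp add: algebra_simps)
  also have "\<dots> = (1 - t) * (\<Sum>n. \<alpha> n * (x n - l)) + t * (\<Sum>n. \<beta> n * (x n - l))"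
    using s by (simp add: suminf_add[symmetric] suminf_mult summable_mult)
  finally show ?thesis by (simp add: mix_def algebra_simps)
qed

lemma continuous_on_mix:
  assumes "x \<longlonglongrightarrow> l"
  shows "continuous_on subprob (\<lambda>\<alpha>. mix \<alpha> x l)"
  unfolding mix_def using assms
  by (intro continuous_on_add continuous_on_const continuous_on_subprob) (simp add: LIM_zero)

text \<open>The differences \<open>h n u - l u\<close> need not be convex in \<open>u\<close>, so
  the form in \<open>mix_eq\<close> is used: there all functions are convex and all coefficients
  nonnegative.\<close>

lemma convex_on_mix:
  assumes "\<alpha> \<in> subprob" "\<And>n. convex_on C (h n)" "\<And>u. u \<in> C \<Longrightarrow> (\<lambda>n. h n u) \<longlonglongrightarrow> l u"
  shows "convex_on C (\<lambda>u. mix \<alpha> (\<lambda>n. h n u) (l u))"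
proof -
  have a: "\<And>n. 0 \<le> \<alpha> n" "(\<Sum>n. \<alpha> n) \<le> 1" using assms(1) by (auto simp: subprob_iff)
  have "summable (\<lambda>n. \<alpha> n * h n u)" if "u \<in> C" for u
    using subprob_summable_mult assms(1,3) that convergent_imp_Bseq convergentI by blast
  then have "convex_on C (\<lambda>u. \<Sum>n. \<alpha> n * h n u)"
    using assms(2) a(1) by (intro convex_on_sum_inf)
  moreover have "convex_on C (\<lambda>u. (1 - (\<Sum>n. \<alpha> n)) * l u)"
    using convex_on_pointwise_limit[OF assms(2,3)] a(2) by (intro convex_on_cmul) auto
  ultimately have "convex_on C (\<lambda>u. (1 - (\<Sum>n. \<alpha> n)) * l u + (\<Sum>n. \<alpha> n * h n u))"
    by (rule convex_on_add[rotated])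
  moreover have "mix \<alpha> (\<lambda>n. h n u) (l u) = (1 - (\<Sum>n. \<alpha> n)) * l u + (\<Sum>n. \<alpha> n * h n u)"
    if "u \<in> C" for u using mix_eq assms(1,3) that by blast
  \<comment> \<open>The two expressions agree only on \<open>C\<close>; convexity of
    \<open>C\<close> keeps the intermediate points inside it.\<close>
  ultimately show ?thesis by (simp add: convex_on_def convex_def)
qed

text \<open>Unit masses produce the values \<open>x n\<close>. Strictness survives the supremum
  because \<open>mix\<close> attains its maximum over the compact set of weights, and this maximum
  is still below \<open>c\<close>.\<close>

lemma SUP_less_of_mix_less:
  fixes c :: real
  assumes x: "x \<longlonglongrightarrow> l" and neg: "\<And>\<alpha>. \<alpha> \<in> subprob \<Longrightarrow> mix \<alpha> x l < c"
  shows "(SUP n. x n) < c"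
proof -
  \<comment> \<open>All mass sits at infinity here; this shows that the maximum is taken over a
    nonempty set.\<close>
  have "(\<lambda>_. 0) \<in> subprob" by (simp add: subprob_def)
  then obtain \<beta> where \<beta>: "\<beta> \<in> subprob" "\<And>\<alpha>. \<alpha> \<in> subprob \<Longrightarrow> mix \<alpha> x l \<le> mix \<beta> x l"
    using continuous_attains_sup[OF compact_subprob _ continuous_on_mix[OF x]] by blast
  have "x n \<le> mix \<beta> x l" for n
  proof -
    let ?d = "\<lambda>k. if k = n then 1 else 0 :: real"
    have "?d \<in> subprob" by (simp add: subprob_def)
    moreover have "mix ?d x l = x n"
      using suminf_finite[of "{n}" "\<lambda>k. ?d k * (x k - l)"] by (simp add: mix_def)
    ultimately show ?thesis using \<beta>(2) by metis
  qed
  then have "(SUP n. x n) \<le> mix \<beta> x l" by (intro cSUP_least) auto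
  then show ?thesis using neg[OF \<beta>(1)] by simp
qed

text \<open>An average of the \<open>x n\<close> and their limit \<open>l\<close> cannot exceed the
  supremum, which also bounds \<open>l\<close>.\<close>

lemma mix_le_SUP:
  assumes x: "x \<longlonglongrightarrow> l" and \<alpha>: "\<alpha> \<in> subprob"
  shows "mix \<alpha> x l \<le> (SUP n. x n)"
proof -
  define s where "s = (SUP n. x n)"
  have "bdd_above (range x)"
    by (rule Bseq_bdd_above, rule convergent_imp_Bseq, rule convergentI, rule x)
  then have le: "x n \<le> s" for n unfolding s_def by (intro cSUP_upper) auto
  have l: "l \<le> s" using LIMSEQ_le_const2[OF x] le by blast
  have a: "\<And>n. 0 \<le> \<alpha> n" "summable \<alpha>" "(\<Sum>n. \<alpha> n) \<le> 1" using \<alpha> by (auto simp: subprob_iff)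
  have "summable (\<lambda>n. \<alpha> n * x n)"
    using subprob_summable_mult \<alpha> x convergent_imp_Bseq convergentI by blast
  then have "(\<Sum>n. \<alpha> n * x n) \<le> (\<Sum>n. \<alpha> n * s)"
    using a le by (intro suminf_le mult_left_mono summable_mult2) auto
  also have "\<dots> = (\<Sum>n. \<alpha> n) * s" by (rule suminf_mult2[OF a(2), symmetric])
  finally have "mix \<alpha> x l \<le> (1 - (\<Sum>n. \<alpha> n)) * l + (\<Sum>n. \<alpha> n) * s"
    using mix_eq[OF \<alpha> x] by simp
  also have "\<dots> \<le> (1 - (\<Sum>n. \<alpha> n)) * s + (\<Sum>n. \<alpha> n) * s"
    using a(3) l by (intro add_right_mono mult_left_mono) auto
  finally show ?thesis by (simp add: s_def algebra_simps)
qed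

section \<open>The alternative\<close>

text \<open>Equivalence with a negation expresses that exactly one alternative holds. Convergent
  sequences are bounded, so the real-valued \<open>SUP\<close> in A1 is a genuine supremum for each
  point of \<open>C\<close>.\<close>

theorem theorem2:
  fixes C :: "'a::real_vector set"
    and h :: "nat \<Rightarrow> 'a \<Rightarrow> real"
    and h_inf :: "'a \<Rightarrow> real"
  assumes "C \<noteq> {}"
    and "convex C"
    and "\<And>n. convex_on C (h n)"
    and "\<And>u. u \<in> C \<Longrightarrow> (\<lambda>n. h n u) \<longlonglongrightarrow> h_inf u"
  shows "(\<exists>u0\<in>C. (SUP n. h n u0) < 0) \<longleftrightarrow>
    \<not> (\<exists>(\<alpha>_inf::real) (\<alpha>::nat \<Rightarrow> real).
          \<alpha>_inf \<ge> 0 \<and> (\<forall>n. \<alpha> n \<ge> 0) \<and>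
          summable \<alpha> \<and> \<alpha>_inf + (\<Sum>n. \<alpha> n) = 1 \<and>
          (\<forall>u\<in>C. summable (\<lambda>n. \<alpha> n * h n u) \<and>
                 \<alpha>_inf * h_inf u + (\<Sum>n. \<alpha> n * h n u) \<ge> 0))"
    (is "?A1 \<longleftrightarrow> \<not> ?A2")
proof -
  define F where "F \<alpha> u = mix \<alpha> (\<lambda>n. h n u) (h_inf u)" for \<alpha> u
  have F_eq: "F \<alpha> u = (1 - (\<Sum>n. \<alpha> n)) * h_inf u + (\<Sum>n. \<alpha> n * h n u)"
    if "\<alpha> \<in> subprob" "u \<in> C" for \<alpha> u
    unfolding F_def using mix_eq that assms(4) by blast
  have A2_iff: "?A2 \<longleftrightarrow> (\<exists>\<alpha>\<in>subprob. \<forall>u\<in>C. F \<alpha> u \<ge> 0)"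
  proof
    assume ?A2
    then obtain a \<alpha> where *: "a \<ge> 0" "\<forall>n. \<alpha> n \<ge> 0" "summable \<alpha>" "a + (\<Sum>n. \<alpha> n) = 1"
      "\<forall>u\<in>C. a * h_inf u + (\<Sum>n. \<alpha> n * h n u) \<ge> 0" by blast
    have "\<alpha> \<in> subprob" using * by (simp add: subprob_iff)
    moreover have "a = 1 - (\<Sum>n. \<alpha> n)" using * by simp
    ultimately show "\<exists>\<alpha>\<in>subprob. \<forall>u\<in>C. F \<alpha> u \<ge> 0" using *(5) F_eq by metis
  next
    assume "\<exists>\<alpha>\<in>subprob. \<forall>u\<in>C. F \<alpha> u \<ge> 0"
    then obtain \<alpha> where \<alpha>: "\<alpha> \<in> subprob" "\<forall>u\<in>C. F \<alpha> u \<ge> 0" by blast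
    have "\<forall>u\<in>C. summable (\<lambda>n. \<alpha> n * h n u)"
      using subprob_summable_mult \<alpha>(1) assms(4) convergent_imp_Bseq convergentI by blast
    then show ?A2
      using \<alpha> F_eq by (intro exI[of _ "1 - (\<Sum>n. \<alpha> n)"] exI[of _ \<alpha>]) (auto simp: subprob_iff)
  qed
  have "\<not> ?A2" if ?A1
  proof -
    from that obtain u where u: "u \<in> C" "(SUP n. h n u) < 0" by blast
    have "F \<alpha> u < 0" if "\<alpha> \<in> subprob" for \<alpha>
      using mix_le_SUP[OF assms(4)[OF u(1)] that] u(2) by (simp add: F_def)
    then show ?thesis unfolding A2_iff using u(1) by force
  qed
  moreover have ?A2 if "\<not> ?A1"
    unfolding A2_iff
  proof (rule minimax[OF assms(2,1) _ _ compact_subprob closed_subprob])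
    show "convex_on C (F \<alpha>)" if "\<alpha> \<in> subprob" for \<alpha>
      unfolding F_def using convex_on_mix that assms(3,4) by blast
    show "continuous_on subprob (\<lambda>\<alpha>. F \<alpha> u)" if "u \<in> C" for u
      unfolding F_def using continuous_on_mix assms(4) that by blast
    show "\<exists>\<gamma>\<in>subprob. \<forall>u\<in>C. F \<gamma> u = (1 - t) * F \<alpha> u + t * F \<beta> u"
      if "\<alpha> \<in> subprob" "\<beta> \<in> subprob" "0 \<le> t" "t \<le> 1" for \<alpha> \<beta> t
      using subprob_convex_combination[OF that] mix_convex_combination[OF that(1,2) assms(4)]
      unfolding F_def by blast
    show "\<exists>\<alpha>\<in>subprob. F \<alpha> w \<ge> 0" if "w \<in> C" for w
    proof (rule ccontr)
      assume "\<not> (\<exists>\<alpha>\<in>subprob. F \<alpha> w \<ge> 0)"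
      \<comment> \<open>If every weight were bad at \<open>w\<close>, then \<open>w\<close> itself
        would satisfy A1.\<close>
      then have "(SUP n. h n w) < 0"
        by (intro SUP_less_of_mix_less[OF assms(4)[OF that]]) (force simp: F_def)
      then show False using \<open>\<not> ?A1\<close> that by blast
    qed
  qed
  ultimately show ?thesis by blast
qed

end
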